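(* Let $m\ge3$ and let $\mathsf S(\mathbf d^m)$ be a complete intersection numerical semigroup minimally generated by $\mathbf d^m=\{d_1,\dots,d_m\}$, $\gcd(d_1,\dots,d_m)=1$, with Hilbert series $$H(\mathbf d^m;z)=\sum_{s\in\mathsf S(\mathbf d^m)}z^s=\frac{\prod_{j=1}^{m-1}(1-z^{e_j})}{\prod_{i=1}^m(1-z^{d_i})},\qquad e_j\in\mathbb N .$$ Then $$\prod_{i=1}^{m-1}e_i=\prod_{i=1}^m d_i .$$
   Context: $\mathsf S(\mathbf d^m)=\{\sum_{i=1}^m x_id_i : x_i\in\mathbb Z_{\ge0}\}$; the generating set is minimal, i.e. no $d_i$ is a nonnegative integer combination of the others. The semigroup is called a complete intersection if its first Betti number (the number of minimal generators of the defining ideal of its semigroup ring) equals $m-1$; in that case the numerator of the Hilbert series over the denominator $\prod_{i=1}^m(1-z^{d_i})$ has the form $\prod_{j=1}^{m-1}(1-z^{e_j})$ with positive integers $e_j$. *)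

theory Defs
  imports Complex_Main "HOL-Library.Poly_Mapping"
    "HOL-Computational_Algebra.Polynomial"
    "HOL-Computational_Algebra.Formal_Power_Series"
    "HOL-Algebra.Ideal"
begin

definition semigroup_span :: "nat set \<Rightarrow> (nat \<Rightarrow> nat) \<Rightarrow> nat set" where
  "semigroup_span I d = {\<Sum>i\<in>I. x i * d i | x :: nat \<Rightarrow> nat. True}"

abbreviation gen_semigroup :: "nat \<Rightarrow> (nat \<Rightarrow> nat) \<Rightarrow> nat set" where
  "gen_semigroup m d \<equiv> semigroup_span {1..m} d"

(* Minimality forces the d i to be positive (0 is the empty combination)
   and pairwise distinct. *)
definition minimal_generators :: "nat \<Rightarrow> (nat \<Rightarrow> nat) \<Rightarrow> bool" where
  "minimal_generators m d \<longleftrightarrow> (\<forall>i\<in>{1..m}. d i \<notin> semigroup_span ({1..m} - {i}) d)"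

(* k[x_1, ..., x_m]: a polynomial is a finitely supported map from exponent
   vectors to coefficients, and only the variables x_1, ..., x_m may occur. *)
definition mpoly_ring :: "nat \<Rightarrow> ((nat \<Rightarrow>\<^sub>0 nat) \<Rightarrow>\<^sub>0 'k::field) ring" where
  "mpoly_ring m =
    \<lparr>carrier = {p. \<forall>a\<in>Poly_Mapping.keys p. Poly_Mapping.keys a \<subseteq> {1..m}},
     mult = (*), one = 1, zero = 0, add = (+)\<rparr>"

lemma cring_mpoly_ring: "cring (mpoly_ring m :: ((nat \<Rightarrow>\<^sub>0 nat) \<Rightarrow>\<^sub>0 'k::field) ring)"
proof -
  let ?C = "{p :: (nat \<Rightarrow>\<^sub>0 nat) \<Rightarrow>\<^sub>0 'k. \<forall>a\<in>Poly_Mapping.keys p. Poly_Mapping.keys a \<subseteq> {1..m}}"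
  have add: "p + q \<in> ?C" if "p \<in> ?C" "q \<in> ?C" for p q
    using that Poly_Mapping.keys_add[of p q] by blast
  have mult: "p * q \<in> ?C" if "p \<in> ?C" "q \<in> ?C" for p q
  proof -
    have "Poly_Mapping.keys c \<subseteq> {1..m}" if c: "c \<in> Poly_Mapping.keys (p * q)" for c
    proof -
      obtain a b where "c = a + b" "a \<in> Poly_Mapping.keys p" "b \<in> Poly_Mapping.keys q"
        using Poly_Mapping.keys_mult[of p q] c by blast
      then show ?thesis
        using \<open>p \<in> ?C\<close> \<open>q \<in> ?C\<close> Poly_Mapping.keys_add[of a b] by blast
    qed
    then show ?thesis by blast
  qed
  have neg: "- p \<in> ?C" if "p \<in> ?C" for p
    using that by simp
  have neg_ex: "\<exists>q\<in>?C. q + p = 0" if "p \<in> ?C" for p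
    using neg[OF that] by (intro bexI[of _ "- p"]) simp_all
  have "abelian_group (mpoly_ring m :: ((nat \<Rightarrow>\<^sub>0 nat) \<Rightarrow>\<^sub>0 'k) ring)"
    unfolding mpoly_ring_def
    by (rule abelian_groupI, unfold ring_record_simps)
       (rule add, assumption+, simp, simp add: add.assoc, simp add: add.commute, simp, rule neg_ex)
  moreover have "comm_monoid (mpoly_ring m :: ((nat \<Rightarrow>\<^sub>0 nat) \<Rightarrow>\<^sub>0 'k) ring)"
    unfolding mpoly_ring_def
    by (rule comm_monoidI, unfold ring_record_simps monoid.simps)
       (rule mult, assumption+, simp, simp add: mult.assoc, simp, simp add: mult.commute)
  ultimately show ?thesis
    by (rule cringI) (simp add: mpoly_ring_def distrib_right)
qed

(* Image of p under the k-algebra map x_i \<mapsto> z^(d i). *)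
definition subst_powers ::
    "(nat \<Rightarrow> nat) \<Rightarrow> ((nat \<Rightarrow>\<^sub>0 nat) \<Rightarrow>\<^sub>0 'k::field) \<Rightarrow> 'k poly" where
  "subst_powers d p =
    (\<Sum>a\<in>Poly_Mapping.keys p. smult (Poly_Mapping.lookup p a)
       (\<Prod>i\<in>Poly_Mapping.keys a. Polynomial.monom 1 (d i) ^ Poly_Mapping.lookup a i))"

(* The semigroup ring is the image k[z^(d 1), ..., z^(d m)] of this map on
   k[x_1, ..., x_m]; its defining ideal is the kernel. *)
definition defining_ideal ::
    "nat \<Rightarrow> (nat \<Rightarrow> nat) \<Rightarrow> ((nat \<Rightarrow>\<^sub>0 nat) \<Rightarrow>\<^sub>0 'k::field) set" where
  "defining_ideal m d = {p \<in> carrier (mpoly_ring m). subst_powers d p = 0}"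

(* The minimum exists because k[x_1, ..., x_m] is Noetherian.  The ideal is
   homogeneous for deg x_i = d i, so this is also the common size of all minimal
   homogeneous generating sets. *)
definition first_betti :: "'k::field itself \<Rightarrow> nat \<Rightarrow> (nat \<Rightarrow> nat) \<Rightarrow> nat" where
  "first_betti TYPE('k) m d =
    (LEAST n. \<exists>B. finite B \<and> card B = n \<and> B \<subseteq> carrier (mpoly_ring m) \<and>
       Idl\<^bsub>mpoly_ring m\<^esub> B = (defining_ideal m d :: ((nat \<Rightarrow>\<^sub>0 nat) \<Rightarrow>\<^sub>0 'k) set))"

definition complete_intersection :: "'k::field itself \<Rightarrow> nat \<Rightarrow> (nat \<Rightarrow> nat) \<Rightarrow> bool" where
  "complete_intersection K m d \<longleftrightarrow> first_betti K m d = m - 1"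

definition hilbert_series :: "nat set \<Rightarrow> real fps" where
  "hilbert_series S = Abs_fps (\<lambda>s. if s \<in> S then 1 else 0)"

end

theory Submission
  imports Defs "HOL-Computational_Algebra.Polynomial_FPS"
begin

text \<open>
  The product formula compares the leading behaviour at \<open>z = 1\<close> of two expressions for
  the Hilbert series \<open>H\<close>. Since the generators have greatest common divisor \<open>1\<close>, the
  semigroup contains all large integers (\<open>additive_set_cofinite\<close>), so \<open>H\<close> is a polynomial
  plus the tail of a geometric series. Hence \<open>(1 - z) H\<close> is a polynomial with value \<open>1\<close> at
  \<open>z = 1\<close> (\<open>hilbert_series_cofinite\<close>).

  On the other side, \<open>1 - z\<^sup>n = (1 - z) [n]\<close> with \<open>[n] = 1 + z + \<dots> + z\<^sup>n\<^sup>-\<^sup>1\<close>. There is exactly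
  one more factor in the denominator than in the numerator, so multiplying \<open>H\<close> by \<open>1 - z\<close>
  balances the powers of \<open>1 - z\<close>; cancelling them leaves the polynomial identity
  \<open>(1 - z) H \<Prod>[d\<^sub>i] = \<Prod>[e\<^sub>j]\<close>. Evaluating it at
  \<open>z = 1\<close>, where \<open>[n]\<close> has the value \<open>n\<close>, gives \<open>\<Prod>d\<^sub>i = \<Prod>e\<^sub>j\<close>.
\<close>

section \<open>Numerical semigroups are cofinite\<close>

lemma zero_in_semigroup_span: "0 \<in> semigroup_span I d"
  unfolding semigroup_span_def by (auto intro!: exI[of _ "\<lambda>_. 0"])

lemma semigroup_span_add:
  assumes "a \<in> semigroup_span I d" "b \<in> semigroup_span I d"
  shows "a + b \<in> semigroup_span I d"
proof -
  obtain x y where "a = (\<Sum>i\<in>I. x i * d i)" "b = (\<Sum>i\<in>I. y i * d i)"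
    using assms unfolding semigroup_span_def by blast
  then have "a + b = (\<Sum>i\<in>I. (x i + y i) * d i)"
    by (simp add: sum.distrib distrib_right)
  then show ?thesis
    unfolding semigroup_span_def by (auto intro!: exI[of _ "\<lambda>i. x i + y i"])
qed

lemma generator_in_semigroup_span:
  assumes "finite I" "i \<in> I"
  shows "d i \<in> semigroup_span I d"
proof -
  have "(\<Sum>j\<in>I. of_bool (j = i) * d j) = d i"
    using assms by (subst sum.remove[of _ i]) auto
  then show ?thesis
    unfolding semigroup_span_def by (auto intro!: exI[of _ "\<lambda>j. of_bool (j = i)"])
qed

lemma minimal_generators_pos:
  assumes "minimal_generators m d" "i \<in> {1..m}"
  shows "d i > 0"
  using assms zero_in_semigroup_span[of "{1..m} - {i}" d]
  unfolding minimal_generators_def by (metis gr0I)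

lemma mult_closed_of_add_closed:
  fixes S :: "nat set"
  assumes "0 \<in> S" "\<And>a b. a \<in> S \<Longrightarrow> b \<in> S \<Longrightarrow> a + b \<in> S" "a \<in> S"
  shows "k * a \<in> S"
  using assms by (induction k) auto

text \<open>
  The least positive difference \<open>g\<close> of two elements divides every element, because a nonzero
  remainder modulo \<open>g\<close> would be a smaller difference. So \<open>g = 1\<close> and \<open>S\<close> contains two
  consecutive numbers \<open>a\<close> and \<open>a + 1\<close>, whose combinations include every number from \<open>a\<^sup>2\<close> on.
\<close>

lemma additive_set_cofinite:
  fixes S :: "nat set"
  assumes zero: "0 \<in> S" and add: "\<And>a b. a \<in> S \<Longrightarrow> b \<in> S \<Longrightarrow> a + b \<in> S"
    and gcd: "Gcd S = 1"
  obtains N where "{N..} \<subseteq> S"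
proof -
  note mult = mult_closed_of_add_closed[OF zero add]
  define P where "P g \<longleftrightarrow> g > 0 \<and> (\<exists>a\<in>S. a + g \<in> S)" for g
  have "\<exists>s\<in>S. s > 0"
  proof (rule ccontr)
    assume "\<not> (\<exists>s\<in>S. s > 0)"
    then have "S \<subseteq> {0}" by auto
    then show False using gcd Gcd_0_iff[of S] by simp
  qed
  then have "\<exists>g. P g" unfolding P_def using zero by (metis add_0)
  define g where "g = (LEAST g. P g)"
  have "P g" unfolding g_def using \<open>\<exists>g. P g\<close> by (rule LeastI_ex)
  then obtain a where a: "g > 0" "a \<in> S" "a + g \<in> S" unfolding P_def by blast
  have "g dvd s" if "s \<in> S" for s
  proof (rule ccontr)
    assume "\<not> g dvd s"
    then have r: "0 < s mod g" "s mod g < g"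
      using a(1) by (auto simp: dvd_eq_mod_eq_0)
    have "s div g * (a + g) + s mod g = s div g * a + s"
      by (metis add_mult_distrib2 add.assoc div_mult_mod_eq)
    also have "\<dots> \<in> S" using mult a(2) that add by blast
    finally have "P (s mod g)"
      unfolding P_def using r(1) mult[OF _ _ a(3)] add by blast
    then have "g \<le> s mod g" unfolding g_def by (rule Least_le)
    then show False using r(2) by simp
  qed
  then have "g dvd Gcd S" by (rule Gcd_greatest)
  then have a1: "a + 1 \<in> S" using gcd a(3) by simp
  have "n \<in> S" if n: "n \<ge> a * a" for n
  proof (cases "a = 0")
    case True
    then show ?thesis using mult[OF _ _ a1, of n] add by simp
  next
    case False
    have "n mod a \<le> n div a"
      using False n
      by (metis div_le_mono less_imp_le le_trans mod_less_divisor nonzero_mult_div_cancel_left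
          bot_nat_0.not_eq_extremum)
    \<comment> \<open>Trade \<open>n mod a\<close> of the \<open>n div a\<close> copies of \<open>a\<close> for copies of \<open>a + 1\<close>.\<close>
    then have "(n div a - n mod a) * a + n mod a * (a + 1) = n div a * a + n mod a"
      by (simp add: diff_mult_distrib algebra_simps)
    then have "(n div a - n mod a) * a + n mod a * (a + 1) = n" by simp
    then show ?thesis using add mult[OF _ _ a(2)] mult[OF _ _ a1] by metis
  qed
  then show thesis by (intro that[of "a * a"]) auto
qed

lemma gen_semigroup_cofinite:
  assumes "Gcd (d ` {1..m}) = 1"
  obtains N where "{N..} \<subseteq> gen_semigroup m d"
proof (rule additive_set_cofinite)
  have "Gcd (gen_semigroup m d) dvd Gcd (d ` {1..m})"
    by (intro Gcd_greatest) (auto intro!: Gcd_dvd generator_in_semigroup_span)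
  then show "Gcd (gen_semigroup m d) = 1" using assms by simp
qed (auto intro: zero_in_semigroup_span semigroup_span_add that)

section \<open>Polynomial factors and their values at one\<close>

text \<open>The polynomial \<open>[n] = 1 + z + \<dots> + z\<^sup>n\<^sup>-\<^sup>1\<close>, the \<open>q\<close>-analogue of \<open>n\<close>.\<close>

definition geometric_poly :: "nat \<Rightarrow> real poly" where
  "geometric_poly n = (\<Sum>k<n. [:0, 1:] ^ k)"

lemma poly_geometric_poly_1: "poly (geometric_poly n) 1 = real n"
  by (simp add: geometric_poly_def poly_sum)

lemma one_minus_X_power_factor:
  "1 - fps_X ^ n = (1 - fps_X) * fps_of_poly (geometric_poly n)"
  by (simp add: geometric_poly_def fps_of_poly_sum fps_of_poly_power one_diff_power_eq)

lemma prod_one_minus_X_power: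
  "(\<Prod>i\<in>I. 1 - fps_X ^ f i) =
    (1 - fps_X) ^ card I * fps_of_poly (\<Prod>i\<in>I. geometric_poly (f i))"
  unfolding one_minus_X_power_factor by (simp add: prod.distrib fps_of_poly_prod)

lemma fps_nth_0_prod:
  fixes f :: "'a \<Rightarrow> 'b::comm_ring_1 fps"
  shows "fps_nth (\<Prod>i\<in>I. f i) 0 = (\<Prod>i\<in>I. fps_nth (f i) 0)"
  by (induction I rule: infinite_finite_induct) auto

text \<open>
  Splitting off the elements below \<open>N\<close> leaves the tail \<open>z\<^sup>N / (1 - z)\<close>; after multiplication by
  \<open>1 - z\<close> only that tail contributes to the value at \<open>1\<close>.
\<close>

lemma hilbert_series_cofinite:
  assumes "{N..} \<subseteq> S"
  obtains p where "(1 - fps_X) * hilbert_series S = fps_of_poly p" "poly p 1 = 1"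
proof
  define q where "q = (\<Sum>s\<in>S \<inter> {..<N}. monom (1::real) s)"
  let ?p = "(1 - [:0, 1:]) * q + [:0, 1:] ^ N"
  have tail: "(1 - fps_X) * Abs_fps (\<lambda>_. 1 :: real) = 1"
    by (rule fps_ext) (auto simp: left_diff_distrib)
  have "hilbert_series S = fps_of_poly q + fps_X ^ N * Abs_fps (\<lambda>_. 1)"
  proof (rule fps_ext)
    fix n
    have "coeff q n = (if n \<in> S \<and> n < N then 1 else 0)"
      by (simp add: q_def coeff_sum)
    then show "fps_nth (hilbert_series S) n =
        fps_nth (fps_of_poly q + fps_X ^ N * Abs_fps (\<lambda>_. 1)) n"
      using assms by (auto simp: hilbert_series_def fps_X_power_mult_nth)
  qed
  then have "(1 - fps_X) * hilbert_series S =
      (1 - fps_X) * fps_of_poly q + fps_X ^ N * ((1 - fps_X) * Abs_fps (\<lambda>_. 1))"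
    by (simp add: algebra_simps)
  then show "(1 - fps_X) * hilbert_series S = fps_of_poly ?p"
    by (simp add: tail fps_of_poly_add fps_of_poly_mult fps_of_poly_diff fps_of_poly_power)
  show "poly ?p 1 = 1" by simp
qed

section \<open>The product formula\<close>

theorem corollary2:
  fixes m :: nat and d e :: "nat \<Rightarrow> nat"
  assumes "m \<ge> 3"
    and "Gcd (d ` {1..m}) = 1"
    and "minimal_generators m d"
    and "complete_intersection TYPE('k::field) m d"
    and "\<forall>j\<in>{1..m-1}. e j > 0"
    and "hilbert_series (gen_semigroup m d) =
      (\<Prod>j=1..m-1. 1 - fps_X ^ e j) / (\<Prod>i=1..m. 1 - fps_X ^ d i)"
  shows "(\<Prod>j=1..m-1. e j) = (\<Prod>i=1..m. d i)"
proof -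
  let ?H = "hilbert_series (gen_semigroup m d)"
  let ?D = "\<Prod>i=1..m. 1 - fps_X ^ d i :: real fps"
  let ?GD = "\<Prod>i=1..m. geometric_poly (d i)" and ?GE = "\<Prod>j=1..m-1. geometric_poly (e j)"
  obtain N where "{N..} \<subseteq> gen_semigroup m d"
    using gen_semigroup_cofinite[OF assms(2)] .
  then obtain p where p: "(1 - fps_X) * ?H = fps_of_poly p" "poly p 1 = 1"
    by (rule hilbert_series_cofinite)
  \<comment> \<open>All \<open>d\<^sub>i\<close> are positive, so the denominator is an invertible power series.\<close>
  have "fps_nth ?D 0 = (\<Prod>i=1..m. fps_nth (1 - fps_X ^ d i) 0)"
    by (simp add: fps_nth_0_prod)
  also have "\<dots> = 1"
    by (intro prod.neutral) (auto simp: minimal_generators_pos[OF assms(3)])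
  finally have "fps_nth ?D 0 = 1" .
  then have "?H * ?D = (\<Prod>j=1..m-1. 1 - fps_X ^ e j)"
    unfolding assms(6) by (simp add: fps_divide_unit mult.assoc inverse_mult_eq_1)
  then have "?H * ((1 - fps_X) ^ m * fps_of_poly ?GD) =
      (1 - fps_X) ^ (m - 1) * fps_of_poly ?GE"
    unfolding prod_one_minus_X_power by simp
  moreover have "(1 - fps_X :: real fps) ^ m = (1 - fps_X) ^ (m - 1) * (1 - fps_X)"
    using assms(1) by (metis Suc_diff_1 less_le_trans power_Suc2 zero_less_numeral)
  ultimately have "(1 - fps_X) ^ (m - 1) * (((1 - fps_X) * ?H) * fps_of_poly ?GD) =
      (1 - fps_X) ^ (m - 1) * fps_of_poly ?GE"
    by (simp only: mult_ac)
  moreover have "(1 - fps_X :: real fps) \<noteq> 0"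
    by (metis fps_X_neq_one eq_iff_diff_eq_0)
  ultimately have "fps_of_poly (p * ?GD) = fps_of_poly ?GE"
    using p(1) by (simp add: fps_of_poly_mult)
  then have "p * ?GD = ?GE" by simp
  then have "poly p 1 * (\<Prod>i=1..m. real (d i)) = (\<Prod>j=1..m-1. real (e j))"
    by (metis (no_types, lifting) poly_geometric_poly_1 poly_mult poly_prod prod.cong)
  then have "real (\<Prod>j=1..m-1. e j) = real (\<Prod>i=1..m. d i)" using p(2) by simp
  then show ?thesis by (simp only: of_nat_eq_iff)
qed

end
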